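(* There exist constants $c_0$ and $c_1$ such that, for large real numbers $x\geq 1$ (that is, as $x\to\infty$), $$\sum_{n \leq x} \frac{1}{\varphi(n)} =c_0+c_1\log x +O\left (\frac{\log x}{x} \right ).$$
   Context: $\varphi$ denotes the Euler totient function, and the sum runs over positive integers $n\le x$. The implied constant is absolute. *)

theory Defs
  imports
    Complex_Main
    "HOL-Library.Landau_Symbols"
    "HOL-Number_Theory.Totient"
begin

end

theory Submission
  imports Defs "HOL-Computational_Algebra.Squarefree" "HOL-Analysis.Harmonic_Numbers"
begin

text \<open>
  Expanding $n/\varphi(n) = \prod_{p \mid n} (1 + 1/(p-1))$ gives
  $n/\varphi(n) = \sum_{d \mid n} \mu^2(d)/\varphi(d)$, so with $a_d = \mu^2(d)/(d\varphi(d))$ the sum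
  equals $\sum_{d \le x} a_d H_{\lfloor x/d \rfloor}$. Inserting
  $H_{\lfloor t \rfloor} = \ln t + \gamma + O(1/t)$ leaves the error
  $\frac1x \sum_{d \le x} 1/\varphi(d)$ and the tail of $\sum_d a_d(\ln (x/d) + \gamma)$. The former is
  $O(\log x / x)$, since the same identity bounds the sum by $H_{\lfloor x \rfloor} \sum_d a_d$. The latter is
  $O(1/x)$: as $\ln (d/x) \le 2\sqrt{d/x}$, it is controlled by
  $x^{-1/2} \sum_{d > x} 1/(\sqrt d\, \varphi(d))$, to which the identity applies once more.
\<close>

section \<open>Product formulas for the totient function\<close>

lemma squarefree_eq_prod_prime_factors:
  fixes d :: nat
  assumes "squarefree d"
  shows "\<Prod>(prime_factors d) = d"
proof -
  have d: "d > 0"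
    using assms by (cases "d = 0") auto
  have "d = (\<Prod>p\<in>prime_factors d. p ^ multiplicity p d)"
    using d by (rule prime_factorization_nat)
  also have "\<dots> = \<Prod>(prime_factors d)"
    using assms d squarefree_factorial_semiring'[of d] by (intro prod.cong) auto
  finally show ?thesis by simp
qed

lemma totient_prod_primes:
  assumes "\<And>p. p \<in> B \<Longrightarrow> prime p"
  shows "totient (\<Prod>B) = (\<Prod>p\<in>B. p - 1)"
proof -
  have "totient (prod id B) = (\<Prod>p\<in>B. totient (id p))"
    using assms by (intro totient_prod_coprime) (auto simp: pairwise_def intro: primes_coprime)
  also have "\<dots> = (\<Prod>p\<in>B. p - 1)"
    using assms by (intro prod.cong) (auto simp: totient_prime)
  finally show ?thesis by simp
qed

lemma prime_factors_prod_primes: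
  fixes B :: "nat set"
  assumes "finite B" "\<And>p. p \<in> B \<Longrightarrow> prime p"
  shows "prime_factors (\<Prod>B) = B"
proof -
  have "prime_factors (prod id B) = (\<Union>p\<in>B. prime_factors p)"
    using assms by (subst prime_factors_prod) (auto, metis not_prime_0)
  also have "\<dots> = (\<Union>p\<in>B. {p})"
    using assms by (intro SUP_cong) (auto simp: prime_factorization_prime)
  finally show ?thesis by simp
qed

text \<open>This is mu(d)^2 / phi(d); the value 0 off the squarefree numbers lets later sums run
  over all divisors.\<close>

definition squarefree_totient_recip :: "nat \<Rightarrow> real" where
  "squarefree_totient_recip d = (if squarefree d then 1 / real (totient d) else 0)"

text \<open>Multiplying out the Euler product gives one term for each set of primes dividing
  \<open>n\<close>; taking products matches these sets with the squarefree divisors of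
  \<open>n\<close>.\<close>

lemma over_totient_eq_sum_divisors:
  assumes "n > 0"
  shows "real n / real (totient n) = (\<Sum>d | d dvd n. squarefree_totient_recip d)"
proof -
  let ?P = "prime_factors n"
  have prime: "prime p" if "p \<in> ?P" for p
    using that by auto
  have "real n / real (totient n) = 1 / (\<Prod>p\<in>?P. 1 - 1 / real p)"
    using assms by (subst totient_formula2) (simp add: divide_simps)
  also have "\<dots> = (\<Prod>p\<in>?P. 1 / (1 - 1 / real p))"
    by (simp add: prod_dividef)
  also have "\<dots> = (\<Prod>p\<in>?P. 1 / real (p - 1) + 1)"
  proof (intro prod.cong refl)
    fix p assume "p \<in> ?P"
    then have "p > 1"
      using prime prime_gt_1_nat by blast
    then show "1 / (1 - 1 / real p) = 1 / real (p - 1) + 1"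
      by (simp add: of_nat_diff divide_simps)
  qed
  also have "\<dots> = (\<Sum>B\<in>Pow ?P. \<Prod>p\<in>B. 1 / real (p - 1))"
    by (subst prod_add) auto
  also have "\<dots> = (\<Sum>d | d dvd n \<and> squarefree d. 1 / real (totient d))"
  proof (rule sum.reindex_bij_witness[where i = prime_factors and j = "\<lambda>B. \<Prod>B"])
    fix B assume "B \<in> Pow ?P"
    then have B: "B \<subseteq> ?P" by simp
    then have fin: "finite B" and pr: "\<And>p. p \<in> B \<Longrightarrow> prime p"
      using finite_subset prime by auto
    show "prime_factors (\<Prod>B) = B"
      using fin pr by (rule prime_factors_prod_primes)
    have "\<Prod>B dvd \<Prod>?P"
      using B by (intro prod_dvd_prod_subset) auto
    also have "\<dots> dvd (\<Prod>p\<in>?P. p ^ multiplicity p n)"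
      by (intro prod_dvd_prod) (auto simp: prime_factors_multiplicity intro!: dvd_power)
    also have "\<dots> = n"
      using prime_factorization_nat[OF assms] by simp
    finally have "\<Prod>B dvd n" .
    moreover have "squarefree (\<Prod>B)"
      using pr by (intro squarefree_prod_coprime) (auto intro: primes_coprime squarefree_prime)
    ultimately show "\<Prod>B \<in> {d. d dvd n \<and> squarefree d}" by simp
    show "1 / real (totient (\<Prod>B)) = (\<Prod>p\<in>B. 1 / real (p - 1))"
      using totient_prod_primes[OF pr] by (simp add: prod_dividef)
  next
    fix d assume "d \<in> {d. d dvd n \<and> squarefree d}"
    then show "\<Prod>(prime_factors d) = d" "prime_factors d \<in> Pow ?P"
      using squarefree_eq_prod_prime_factors assms by (auto dest: dvd_prime_factors[rotated])
  qed
  also have "\<dots> = (\<Sum>d | d dvd n. squarefree_totient_recip d)"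
    using assms unfolding squarefree_totient_recip_def by (intro sum.mono_neutral_cong_left) auto
  finally show ?thesis .
qed

text \<open>By multiplicativity it suffices to compare prime powers: p <= (p - 1)^2 for p >= 3, and
  only p = 2 costs a factor 2. The resulting bound phi(n) >= sqrt (n/2) is crude but enough for the
  convergence of the sum of the a_d.\<close>

lemma le_two_totient_squared: "n \<le> 2 * totient n ^ 2"
proof (cases "n = 0")
  case False
  then have n: "n > 0" by simp
  let ?P = "prime_factors n"
  let ?f = "\<lambda>p. p ^ (multiplicity p n - 1) * (p - 1)"
  let ?c = "\<lambda>p::nat. if p = 2 then 2 else (1::nat)"
  have "p ^ multiplicity p n \<le> ?c p * ?f p ^ 2" if "p \<in> ?P" for p
  proof -
    have "multiplicity p n > 0"
      using that prime_factors_multiplicity by blast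
    then obtain k where k: "multiplicity p n = Suc k"
      using gr0_implies_Suc by blast
    have "p > 1"
      using that prime_gt_1_nat by blast
    then have "p \<le> ?c p * (p - 1) ^ 2"
    proof (cases "p = 2")
      case False
      \<comment> \<open>The substitution removes the truncated subtraction in
        \<open>p - 1\<close>.\<close>
      with \<open>p > 1\<close> obtain q where "p = q + 3"
        using le_Suc_ex[of 3 p] by (auto simp: add.commute)
      then show ?thesis by (simp add: power2_eq_square)
    qed simp
    moreover have "p ^ k \<le> (p ^ k) ^ 2"
      using \<open>p > 1\<close> by (simp add: power2_eq_square)
    ultimately have "p ^ k * p \<le> (p ^ k) ^ 2 * (?c p * (p - 1) ^ 2)"
      by (rule mult_le_mono[rotated])
    then show ?thesis
      by (simp add: k power_mult_distrib mult_ac)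
  qed
  then have "(\<Prod>p\<in>?P. p ^ multiplicity p n) \<le> (\<Prod>p\<in>?P. ?c p * ?f p ^ 2)"
    by (intro prod_mono) auto
  also have "\<dots> = (\<Prod>p\<in>?P. ?c p) * totient n ^ 2"
    unfolding totient_formula1[OF n] prod_power_distrib
    by (simp only: prod.distrib prod_power_distrib)
  also have "(\<Prod>p\<in>?P. ?c p) \<le> 2"
    by (subst prod.delta) auto
  finally show ?thesis
    using False prime_factorization_nat[of n] by simp
qed simp

section \<open>Rearranging divisor sums, and tails of the series of m^(-3/2)\<close>

lemma sum_divisors_swap:
  fixes F :: "nat \<Rightarrow> nat \<Rightarrow> 'a :: comm_monoid_add"
  shows "(\<Sum>n\<in>{1..N}. \<Sum>d | d dvd n. F d (n div d)) = (\<Sum>d\<in>{1..N}. \<Sum>m\<in>{1..N div d}. F d m)"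
proof -
  have le: "b \<le> N" if "b * k \<le> N" "0 < k" for b k
    using that by (intro le_trans[OF _ that(1)]) simp
  have "(\<Sum>n\<in>{1..N}. \<Sum>d | d dvd n. F d (n div d)) =
        (\<Sum>(n, d)\<in>(SIGMA n:{1..N}. {d. d dvd n}). F d (n div d))"
    by (intro sum.Sigma) auto
  \<comment> \<open>Writing \<open>n = d * m\<close>, the condition n <= N becomes m <= N div
    d.\<close>
  also have "\<dots> = (\<Sum>(d, m)\<in>(SIGMA d:{1..N}. {1..N div d}). F d m)"
    by (rule sum.reindex_bij_witness[where j = "\<lambda>(n, d). (d, n div d)" and i = "\<lambda>(d, m). (d * m, d)"])
       (auto simp: less_eq_div_iff_mult_less_eq mult.commute Suc_le_eq
             intro: le elim!: dvdE)
  also have "\<dots> = (\<Sum>d\<in>{1..N}. \<Sum>m\<in>{1..N div d}. F d m)"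
    by (intro sum.Sigma[symmetric]) auto
  finally show ?thesis .
qed

text \<open>The bound is uniform in \<open>K\<close> and allows any positive real \<open>y\<close>,
  also below 1: it is applied with \<open>y\<close> = x/d for d possibly larger than x, and with a
  small \<open>y\<close> to cover the whole series.\<close>

lemma sum_tail_three_halves_le:
  fixes y :: real
  assumes "y > 0"
  shows "(\<Sum>m\<in>{1..K}. if real m > y then 1 / (real m * sqrt (real m)) else 0) \<le> 4 / sqrt y"
proof -
  \<comment> \<open>Telescoping; capping at \<open>y\<close> makes the bound hold termwise for all \<open>m\<close>.\<close>
  define v where "v m = 1 / sqrt (max (real m) y)" for m
  have v_pos: "v m > 0" for m
    using assms by (simp add: v_def)
  have step: "(if real m > y then 1 / (real m * sqrt (real m)) else 0) \<le> 4 * (v m - v (Suc m))"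
    if "m \<ge> 1" for m
  proof (cases "real m > y")
    case True
    define s t where "s = sqrt (real m)" and "t = sqrt (real (Suc m))"
    have s: "s \<ge> 1" "s ^ 2 = real m" and t: "t > s" "t ^ 2 = real m + 1"
      using that by (auto simp: s_def t_def)
    \<comment> \<open>Since m + 1 <= 2m and 2 <= 9/4, t <= 3/2 s. Then t (t + s) <= 15/4 s^2, which
      is where the constant 4 comes from.\<close>
    have "t ^ 2 \<le> 2 * s ^ 2"
      using s t that by simp
    also have "\<dots> \<le> (3 / 2 * s) ^ 2"
      by (simp add: power2_eq_square)
    finally have t_le: "t \<le> 3 / 2 * s"
      by (rule power2_le_imp_le) (use s in auto)
    have "t * (t + s) \<le> (3 / 2 * s) * (3 / 2 * s + s)"
      using t_le s t by (intro mult_mono) auto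
    also have "\<dots> \<le> 4 * s ^ 2"
      by (simp add: power2_eq_square)
    finally have "t * (t + s) \<le> 4 * s ^ 2" .
    then have "1 / (s ^ 2) \<le> 4 / (t * (t + s))"
      using s t by (simp add: divide_simps)
    then have "1 / (s ^ 2) / s \<le> 4 / (t * (t + s)) / s"
      using s by (intro divide_right_mono) auto
    also have "\<dots> = 4 * ((t ^ 2 - s ^ 2) / (t * (t + s) * s))"
      using s t by simp
    also have "t ^ 2 - s ^ 2 = (t - s) * (t + s)"
      by (simp add: power2_eq_square algebra_simps)
    also have "4 * ((t - s) * (t + s) / (t * (t + s) * s)) = 4 * (1 / s - 1 / t)"
      using s t by (simp add: divide_simps)
    finally show ?thesis
      using True s by (simp add: v_def s_def t_def max_def)
  next
    case False
    have "v (Suc m) \<le> v m"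
      using assms unfolding v_def by (intro divide_left_mono) auto
    then show ?thesis using False by simp
  qed
  have "(\<Sum>m\<in>{1..K}. if real m > y then 1 / (real m * sqrt (real m)) else 0)
        \<le> (\<Sum>m\<in>{1..K}. 4 * (v m - v (Suc m)))"
    using step by (intro sum_mono) auto
  also have "\<dots> = 4 * (\<Sum>m\<in>{1..K}. v m - v (Suc m))"
    by (simp add: sum_distrib_left)
  also have "(\<Sum>m\<in>{1..K}. v m - v (Suc m)) = v 1 - v (Suc K)"
    by (induction K) auto
  also have "\<dots> \<le> v 1"
    using v_pos[of "Suc K"] by simp
  also have "v 1 \<le> 1 / sqrt y"
    using assms unfolding v_def by (intro divide_left_mono) auto
  finally show ?thesis by simp
qed

section \<open>The weights a_d, encoded as \<open>divisor_weight\<close>, and their convergent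
  sum\<close>

definition divisor_weight :: "nat \<Rightarrow> real" where
  "divisor_weight d = squarefree_totient_recip d / real d"

lemma divisor_weight_nonneg: "divisor_weight d \<ge> 0"
  by (simp add: divisor_weight_def squarefree_totient_recip_def)

lemma divisor_weight_le: "divisor_weight d \<le> 1 / (real d * real (totient d))"
  by (simp add: divisor_weight_def squarefree_totient_recip_def mult.commute)

text \<open>The lower bound phi(d) >= sqrt d / 2 gives a_d <= 2 d^(-3/2), so the tail bound for that
  exponent controls all partial sums.\<close>

lemma summable_divisor_weight: "summable divisor_weight"
proof (rule summableI_nonneg_bounded)
  show "divisor_weight d \<ge> 0" for d
    by (rule divisor_weight_nonneg)
  fix n
  have le: "divisor_weight d \<le> 2 * (1 / (real d * sqrt (real d)))" if "d \<ge> 1" for d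
  proof -
    have "real d \<le> 2 * real (totient d) ^ 2"
      using le_two_totient_squared[of d] by (metis of_nat_le_iff of_nat_mult of_nat_numeral of_nat_power)
    also have "\<dots> \<le> (2 * real (totient d)) ^ 2"
      by (simp add: power2_eq_square)
    finally have "sqrt (real d) \<le> 2 * real (totient d)"
      by (intro real_le_lsqrt) auto
    then have "1 / (real d * real (totient d)) \<le> 2 * (1 / (real d * sqrt (real d)))"
      using that by (simp add: divide_simps)
    then show ?thesis
      using divisor_weight_le[of d] by linarith
  qed
  have "(\<Sum>d<n. divisor_weight d) \<le> (\<Sum>d\<in>{0..n}. divisor_weight d)"
    by (intro sum_mono2) (auto simp: divisor_weight_nonneg)
  also have "\<dots> = (\<Sum>d\<in>{1..n}. divisor_weight d)"
    by (simp add: sum.atLeast_Suc_atMost divisor_weight_def)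
  \<comment> \<open>The threshold 1/4 lies below 1, so every d >= 1 passes it and the tail is the
    full sum.\<close>
  also have "\<dots> \<le> (\<Sum>d\<in>{1..n}. 2 * (if real d > 1/4 then 1 / (real d * sqrt (real d)) else 0))"
    using le by (intro sum_mono) force
  also have "\<dots> \<le> 2 * (4 / sqrt (1/4))"
    unfolding sum_distrib_left[symmetric] by (intro mult_left_mono sum_tail_three_halves_le) auto
  finally show "(\<Sum>d<n. divisor_weight d) \<le> 2 * (4 / sqrt (1/4))" .
qed

lemma sum_divisor_weight_le_suminf: "finite D \<Longrightarrow> sum divisor_weight D \<le> suminf divisor_weight"
  using summable_divisor_weight divisor_weight_nonneg by (intro sum_le_suminf) auto

section \<open>Reciprocals of the totient function as divisor convolutions\<close>

lemma recip_totient_eq_sum: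
  assumes "n > 0"
  shows "1 / real (totient n) = (\<Sum>d | d dvd n. divisor_weight d * (1 / real (n div d)))"
proof -
  have "1 / real (totient n) = (\<Sum>d | d dvd n. squarefree_totient_recip d) / real n"
    using assms by (simp flip: over_totient_eq_sum_divisors)
  also have "\<dots> = (\<Sum>d | d dvd n. divisor_weight d * (1 / real (n div d)))"
    unfolding sum_divide_distrib using assms
    by (intro sum.cong) (auto simp: divisor_weight_def elim!: dvdE)
  finally show ?thesis .
qed

lemma sum_recip_totient:
  "(\<Sum>n\<in>{1..N}. 1 / real (totient n)) = (\<Sum>d\<in>{1..N}. divisor_weight d * harm (N div d))"
proof -
  have "(\<Sum>n\<in>{1..N}. 1 / real (totient n)) =
        (\<Sum>n\<in>{1..N}. \<Sum>d | d dvd n. divisor_weight d * (1 / real (n div d)))"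
    by (intro sum.cong recip_totient_eq_sum) auto
  also have "\<dots> = (\<Sum>d\<in>{1..N}. \<Sum>m\<in>{1..N div d}. divisor_weight d * (1 / real m))"
    by (rule sum_divisors_swap)
  finally show ?thesis
    by (simp add: sum_distrib_left harm_def inverse_eq_divide)
qed

text \<open>With n = d m the terms split into a_d / sqrt d times m^(-3/2). For fixed d the condition
  n > x becomes m > x/d, and the tail bound 4 sqrt (d/x) cancels the factor 1 / sqrt d, leaving only
  the sum of the a_d.\<close>

lemma sum_tail_recip_sqrt_totient_le:
  fixes x :: real
  assumes "x > 0"
  shows "(\<Sum>n\<in>{1..M}. if real n > x then 1 / (sqrt (real n) * real (totient n)) else 0)
         \<le> 4 * suminf divisor_weight / sqrt x"
proof -
  define F where "F d m = (if real (d * m) > x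
      then divisor_weight d / sqrt (real d) * (1 / (real m * sqrt (real m))) else 0)" for d m
  have "(\<Sum>n\<in>{1..M}. if real n > x then 1 / (sqrt (real n) * real (totient n)) else 0)
        = (\<Sum>n\<in>{1..M}. \<Sum>d | d dvd n. F d (n div d))"
  proof (intro sum.cong refl)
    fix n assume "n \<in> {1..M}"
    then have n: "n > 0" by simp
    show "(if real n > x then 1 / (sqrt (real n) * real (totient n)) else 0)
          = (\<Sum>d | d dvd n. F d (n div d))"
    proof (cases "real n > x")
      case True
      have "1 / (sqrt (real n) * real (totient n)) = (1 / real (totient n)) / sqrt (real n)"
        by simp
      also have "\<dots> = (\<Sum>d | d dvd n. divisor_weight d * (1 / real (n div d)) / sqrt (real n))"
        unfolding recip_totient_eq_sum[OF n] sum_divide_distrib ..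
      also have "\<dots> = (\<Sum>d | d dvd n. F d (n div d))"
        using True n by (intro sum.cong) (auto simp: F_def real_sqrt_mult elim!: dvdE)
      finally show ?thesis using True by simp
    next
      case False
      then show ?thesis by (auto simp: F_def)
    qed
  qed
  also have "\<dots> = (\<Sum>d\<in>{1..M}. \<Sum>m\<in>{1..M div d}. F d m)"
    by (rule sum_divisors_swap)
  also have "\<dots> \<le> (\<Sum>d\<in>{1..M}. divisor_weight d * (4 / sqrt x))"
  proof (intro sum_mono)
    fix d assume "d \<in> {1..M}"
    then have d: "d > 0" by simp
    have "(\<Sum>m\<in>{1..M div d}. F d m) = divisor_weight d / sqrt (real d) *
       (\<Sum>m\<in>{1..M div d}. if real m > x / real d then 1 / (real m * sqrt (real m)) else 0)"
      unfolding sum_distrib_left F_def using d by (intro sum.cong) (auto simp: field_simps)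
    also have "\<dots> \<le> divisor_weight d / sqrt (real d) * (4 / sqrt (x / real d))"
      using assms d divisor_weight_nonneg[of d]
      by (intro mult_left_mono sum_tail_three_halves_le) auto
    also have "\<dots> = divisor_weight d * (4 / sqrt x)"
      using d by (simp add: real_sqrt_divide)
    finally show "(\<Sum>m\<in>{1..M div d}. F d m) \<le> divisor_weight d * (4 / sqrt x)" .
  qed
  also have "\<dots> = (\<Sum>d\<in>{1..M}. divisor_weight d) * (4 / sqrt x)"
    by (rule sum_distrib_right[symmetric])
  also have "\<dots> \<le> suminf divisor_weight * (4 / sqrt x)"
    using assms by (intro mult_right_mono sum_divisor_weight_le_suminf) auto
  finally show ?thesis by (simp add: mult.commute)
qed

lemma tail_recip_sqrt_totient:
  fixes x :: real
  assumes "x > 0"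
  defines "h \<equiv> \<lambda>n. if real n > x then 1 / (sqrt (real n) * real (totient n)) else 0"
  shows "summable h" "suminf h \<le> 4 * suminf divisor_weight / sqrt x"
proof -
  have le: "(\<Sum>n<M. h n) \<le> 4 * suminf divisor_weight / sqrt x" for M
  proof -
    have "(\<Sum>n<M. h n) \<le> (\<Sum>n\<in>{0..M}. h n)"
      by (intro sum_mono2) (auto simp: h_def)
    also have "\<dots> = (\<Sum>n\<in>{1..M}. h n)"
      by (simp add: sum.atLeast_Suc_atMost h_def)
    also have "\<dots> \<le> 4 * suminf divisor_weight / sqrt x"
      unfolding h_def using assms(1) by (rule sum_tail_recip_sqrt_totient_le)
    finally show ?thesis .
  qed
  show "summable h"
    using le by (intro summableI_nonneg_bounded) (auto simp: h_def)
  then show "suminf h \<le> 4 * suminf divisor_weight / sqrt x"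
    using le by (rule suminf_le_const)
qed

section \<open>Convergence of the logarithmically weighted series\<close>

lemma ln_le_two_sqrt:
  fixes u :: real
  assumes "u > 0"
  shows "ln u \<le> 2 * sqrt u"
  using assms ln_bound[of "sqrt u"] by (simp add: ln_sqrt)

lemma divisor_weight_le_sqrt:
  "divisor_weight n * sqrt (real n) \<le> 1 / (sqrt (real n) * real (totient n))"
proof -
  have "divisor_weight n * sqrt (real n) \<le> 1 / (real n * real (totient n)) * sqrt (real n)"
    by (intro mult_right_mono divisor_weight_le) auto
  also have "\<dots> = 1 / (sqrt (real n) * real (totient n))"
    by (cases "n = 0") (auto simp: field_simps)
  finally show ?thesis .
qed

lemma summable_divisor_weight_ln: "summable (\<lambda>n. divisor_weight n * ln (real n))"
proof (rule summable_comparison_test')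
  \<comment> \<open>The threshold 1/2 keeps every n >= 1, so the tail lemma yields summability of
    the whole series, which dominates because ln n <= 2 sqrt n.\<close>
  let ?h = "\<lambda>n. if real n > 1/2 then 1 / (sqrt (real n) * real (totient n)) else 0"
  show "summable (\<lambda>n. 2 * ?h n)"
    by (intro summable_mult tail_recip_sqrt_totient) auto
  fix n :: nat assume n: "n \<ge> 1"
  have "norm (divisor_weight n * ln (real n)) = divisor_weight n * ln (real n)"
    using n divisor_weight_nonneg[of n] by (simp add: abs_mult)
  also have "\<dots> \<le> divisor_weight n * (2 * sqrt (real n))"
    using n by (intro mult_left_mono ln_le_two_sqrt divisor_weight_nonneg) auto
  also have "\<dots> \<le> 2 * ?h n"
    using n divisor_weight_le_sqrt[of n] by simp
  finally show "norm (divisor_weight n * ln (real n)) \<le> 2 * ?h n" .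
qed

section \<open>Harmonic numbers at a real cutoff\<close>

lemma harm_floor_bound:
  fixes t :: real
  assumes "t \<ge> 1"
  shows "\<bar>harm (nat \<lfloor>t\<rfloor>) - ln t - euler_mascheroni\<bar> \<le> 1 / t"
proof -
  define k where "k = nat \<lfloor>t\<rfloor>"
  have k: "k \<ge> 1" "real k \<le> t" "t \<le> real k + 1"
    using assms unfolding k_def by linarith+
  have em: "euler_mascheroni \<le> harm k - ln (real k + 1) + 1 / (2 * real k)"
           "euler_mascheroni \<ge> harm k - ln (real k + 1)"
  proof -
    have Suc: "real (Suc k) = real k + 1" by simp
    have "harm k - ln (real k + 1) + inverse (real (2 * (k + 1))) \<le> (euler_mascheroni :: real)"
         "euler_mascheroni \<le> harm k - ln (real k + 1) + inverse (real (2 * k))"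
      using euler_mascheroni_bounds[OF k(1)] unfolding Suc by simp_all
    moreover have "inverse (real (2 * k)) = 1 / (2 * real k)" "inverse (real (2 * (k + 1))) \<ge> 0"
      by (simp_all add: inverse_eq_divide)
    ultimately show "euler_mascheroni \<le> harm k - ln (real k + 1) + 1 / (2 * real k)"
                    "euler_mascheroni \<ge> harm k - ln (real k + 1)"
      by linarith+
  qed
  \<comment> \<open>Two errors of opposite sign are combined: H_k - ln (k + 1) - gamma lies in
    [-1/(2k), 0] and ln (k + 1) - ln t in [0, 1/t]. As 2k >= k + 1 >= t, the total stays within
    1/t.\<close>
  have "ln t \<le> ln (real k + 1)"
    using assms k by simp
  moreover have "ln (real k + 1) - ln t \<le> 1 / t"
  proof -
    have "ln (real k + 1) - ln t = ln ((real k + 1) / t)"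
      using assms by (simp add: ln_div)
    also have "\<dots> \<le> (real k + 1) / t - 1"
      using assms by (intro ln_le_minus_one) auto
    also have "\<dots> \<le> 1 / t"
      using assms k by (simp add: field_simps)
    finally show ?thesis .
  qed
  moreover have "1 / (2 * real k) \<le> 1 / t"
    using assms k by (intro divide_left_mono) auto
  ultimately show ?thesis
    using em unfolding k_def[symmetric] by linarith
qed

lemma nat_floor_divide: "nat \<lfloor>x / real d\<rfloor> = nat \<lfloor>x\<rfloor> div d" if "x \<ge> 0"
proof -
  have "\<lfloor>x / real_of_int (int d)\<rfloor> = \<lfloor>x\<rfloor> div int d"
    by (rule floor_divide_real_eq_div) simp
  then show ?thesis
    using that by (simp add: nat_div_distrib)
qed

lemma euler_mascheroni_le_1: "(euler_mascheroni :: real) \<le> 1"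
  using euler_mascheroni_upper[of 0] ln2_ge_two_thirds by (simp add: harm_def)

section \<open>Error terms and the asymptotic expansion\<close>

lemma sum_recip_totient_le:
  fixes x :: real
  assumes "x \<ge> 1"
  shows "(\<Sum>n\<in>{1..nat \<lfloor>x\<rfloor>}. 1 / real (totient n)) \<le> suminf divisor_weight * (ln x + 2)"
proof -
  let ?N = "nat \<lfloor>x\<rfloor>"
  have "(\<Sum>n\<in>{1..?N}. 1 / real (totient n)) = (\<Sum>d\<in>{1..?N}. divisor_weight d * harm (?N div d))"
    by (rule sum_recip_totient)
  also have "\<dots> \<le> (\<Sum>d\<in>{1..?N}. divisor_weight d * (ln x + 2))"
  proof (intro sum_mono mult_left_mono divisor_weight_nonneg)
    fix d assume "d \<in> {1..?N}"
    \<comment> \<open>H_N is at most ln x + gamma + 1/x, and both gamma and 1/x are at most 1; hence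
      the constant 2.\<close>
    have "harm (?N div d) \<le> (harm ?N :: real)"
      by (intro harm_mono) simp
    moreover have "1 / x \<le> 1"
      using assms by simp
    ultimately show "harm (?N div d) \<le> ln x + 2"
      using harm_floor_bound[OF assms] euler_mascheroni_le_1 by linarith
  qed
  also have "\<dots> = (\<Sum>d\<in>{1..?N}. divisor_weight d) * (ln x + 2)"
    by (simp add: sum_distrib_right)
  also have "\<dots> \<le> suminf divisor_weight * (ln x + 2)"
    using assms by (intro mult_right_mono sum_divisor_weight_le_suminf) auto
  finally show ?thesis .
qed

text \<open>This is the cost of completing the main term, a sum over n <= x, to a convergent series.
  The tail loses one factor 1 / sqrt x through ln (n/x) <= 2 sqrt (n/x) and another through the tail
  of 1 / (sqrt n phi(n)).\<close>

lemma divisor_weight_ln_tail: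
  fixes x :: real
  assumes "x \<ge> 1"
  defines "f \<equiv> \<lambda>n. divisor_weight n * (ln x - ln (real n) + euler_mascheroni)"
  shows "summable f" "\<bar>suminf f - (\<Sum>n\<in>{1..nat \<lfloor>x\<rfloor>}. f n)\<bar> \<le> 12 * suminf divisor_weight / x"
proof -
  let ?N = "nat \<lfloor>x\<rfloor>"
  define h where "h = (\<lambda>n. if real n > x then 1 / (sqrt (real n) * real (totient n)) else 0)"
  have f_eq: "f = (\<lambda>n. divisor_weight n * (ln x + euler_mascheroni) - divisor_weight n * ln (real n))"
    by (simp add: f_def algebra_simps fun_eq_iff)
  show f: "summable f"
    unfolding f_eq
    by (intro summable_diff summable_mult2 summable_divisor_weight summable_divisor_weight_ln)
  have h: "summable h" "suminf h \<le> 4 * suminf divisor_weight / sqrt x"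
    using tail_recip_sqrt_totient[of x] assms(1) by (auto simp: h_def)
  \<comment> \<open>Extending the partial sum by zeros makes the tail the series of
    \<open>f n - e n\<close>, which can be compared with \<open>h\<close> term by term.\<close>
  define e where "e n = (if n \<in> {1..?N} then f n else 0)" for n
  have e: "summable e" "suminf e = (\<Sum>n\<in>{1..?N}. f n)"
    using sums_If_finite_set[of "{1..?N}" f] by (simp_all add: e_def[abs_def] sums_iff)
  have le: "norm (f n - e n) \<le> 3 / sqrt x * h n" for n
  proof (cases "real n > x")
    case True
    have n: "n \<notin> {1..?N}" "n > 0"
      using True assms(1) by (auto simp: not_le) linarith
    define q where "q = sqrt (real n / x)"
    have q: "q \<ge> 1"
      using True assms(1) by (simp add: q_def)
    have "ln (real n / x) \<le> 2 * q"
      using assms(1) n unfolding q_def by (intro ln_le_two_sqrt) auto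
    moreover have "ln (real n / x) = ln (real n) - ln x"
      using n assms(1) by (simp add: ln_div)
    moreover have "ln x \<le> ln (real n)"
      using True assms(1) by simp
    \<comment> \<open>The logarithms contribute at most 2q, and gamma <= 1 <= q.\<close>
    ultimately have "\<bar>ln x - ln (real n) + euler_mascheroni\<bar> \<le> 3 * q"
      using q euler_mascheroni_le_1 euler_mascheroni_pos by linarith
    then have "\<bar>f n\<bar> \<le> divisor_weight n * (3 * q)"
      using divisor_weight_nonneg[of n] by (simp add: f_def abs_mult mult_left_mono)
    also have "\<dots> = 3 / sqrt x * (divisor_weight n * sqrt (real n))"
      by (simp add: q_def real_sqrt_divide)
    also have "\<dots> \<le> 3 / sqrt x * (1 / (sqrt (real n) * real (totient n)))"
      using assms(1) by (intro mult_left_mono divisor_weight_le_sqrt) auto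
    finally show ?thesis
      using True n by (simp add: e_def h_def)
  next
    case False
    \<comment> \<open>At n = 0 the difference still vanishes, because
      \<open>divisor_weight 0\<close> is 0.\<close>
    then have "n = 0 \<or> n \<in> {1..?N}"
      by (auto simp: le_nat_floor)
    then show ?thesis
      using False by (auto simp: e_def h_def f_def divisor_weight_def)
  qed
  have "\<bar>suminf f - suminf e\<bar> = norm (\<Sum>n. f n - e n)"
    using suminf_diff[OF f e(1)] by simp
  also have "\<dots> \<le> (\<Sum>n. 3 / sqrt x * h n)"
    using le h(1) by (intro norm_suminf_le summable_mult)
  also have "\<dots> = 3 / sqrt x * suminf h"
    using h(1) by (rule suminf_mult)
  also have "\<dots> \<le> 3 / sqrt x * (4 * suminf divisor_weight / sqrt x)"
    using h(2) assms(1) by (intro mult_left_mono) auto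
  also have "\<dots> = 12 * suminf divisor_weight / x"
    using assms(1) by simp
  finally show "\<bar>suminf f - (\<Sum>n\<in>{1..?N}. f n)\<bar> \<le> 12 * suminf divisor_weight / x"
    unfolding e .
qed

text \<open>The constants are c_1 = \<open>A\<close> and c_0 = \<open>A\<close> gamma -
  \<open>B\<close>. The remainders of the harmonic sums cost \<open>A\<close> (ln x + 2) / x and
  completing the series costs 12 \<open>A\<close> / x, which add up to the 14.\<close>

lemma sum_recip_totient_asymptotic:
  fixes x :: real
  assumes "x \<ge> 1"
  defines "A \<equiv> suminf divisor_weight"
    and "B \<equiv> (\<Sum>n. divisor_weight n * ln (real n))"
  shows "\<bar>(\<Sum>n\<in>{1..nat \<lfloor>x\<rfloor>}. 1 / real (totient n)) - (A * euler_mascheroni - B + A * ln x)\<bar>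
         \<le> A * (ln x + 14) / x"
proof -
  let ?N = "nat \<lfloor>x\<rfloor>"
  define f where "f n = divisor_weight n * (ln x - ln (real n) + euler_mascheroni)" for n
  have f_sum: "suminf f = A * euler_mascheroni - B + A * ln x"
  proof -
    have "f = (\<lambda>n. divisor_weight n * (ln x + euler_mascheroni) - divisor_weight n * ln (real n))"
      by (simp add: f_def algebra_simps fun_eq_iff)
    then have "suminf f = A * (ln x + euler_mascheroni) - B"
      unfolding A_def B_def using summable_divisor_weight summable_divisor_weight_ln
      by (simp add: suminf_diff suminf_mult2 summable_mult2)
    then show ?thesis by (simp add: algebra_simps)
  qed
  have "\<bar>(\<Sum>n\<in>{1..?N}. 1 / real (totient n)) - (\<Sum>n\<in>{1..?N}. f n)\<bar>
        = \<bar>\<Sum>d\<in>{1..?N}. divisor_weight d * (harm (?N div d) - ln (x / real d) - euler_mascheroni)\<bar>"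
    unfolding sum_recip_totient sum_subtractf[symmetric] f_def using assms(1)
    by (intro arg_cong[where f = abs] sum.cong) (auto simp: ln_div algebra_simps)
  also have "\<dots> \<le> (\<Sum>d\<in>{1..?N}. 1 / real (totient d) / x)"
  proof (intro sum_abs[THEN order_trans] sum_mono)
    fix d assume "d \<in> {1..?N}"
    then have d: "d > 0" "real d \<le> x"
      by auto linarith
    have "\<bar>harm (?N div d) - ln (x / real d) - euler_mascheroni\<bar> \<le> 1 / (x / real d)"
      using harm_floor_bound[of "x / real d"] nat_floor_divide[of x d] assms(1) d by simp
    then have "\<bar>divisor_weight d * (harm (?N div d) - ln (x / real d) - euler_mascheroni)\<bar>
          \<le> divisor_weight d * (1 / (x / real d))"
      unfolding abs_mult abs_of_nonneg[OF divisor_weight_nonneg]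
      by (rule mult_left_mono[OF _ divisor_weight_nonneg])
    \<comment> \<open>The factor d in the remainder d/x cancels the d in the denominator of a_d, so
      the total error is the original sum divided by x.\<close>
    also have "\<dots> \<le> 1 / (real d * real (totient d)) * (1 / (x / real d))"
      using assms(1) by (intro mult_right_mono divisor_weight_le) auto
    also have "\<dots> = 1 / real (totient d) / x"
      using d by simp
    finally show "\<bar>divisor_weight d * (harm (?N div d) - ln (x / real d) - euler_mascheroni)\<bar>
          \<le> 1 / real (totient d) / x" .
  qed
  also have "\<dots> = (\<Sum>d\<in>{1..?N}. 1 / real (totient d)) / x"
    by (simp add: sum_divide_distrib)
  also have "\<dots> \<le> A * (ln x + 2) / x"
    unfolding A_def using assms(1) by (intro divide_right_mono sum_recip_totient_le) auto
  finally have "\<bar>(\<Sum>n\<in>{1..?N}. 1 / real (totient n)) - (\<Sum>n\<in>{1..?N}. f n)\<bar> \<le> A * (ln x + 2) / x" .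
  moreover have "\<bar>suminf f - (\<Sum>n\<in>{1..?N}. f n)\<bar> \<le> 12 * A / x"
    unfolding A_def f_def[abs_def] using assms(1) by (rule divisor_weight_ln_tail)
  moreover have "A * (ln x + 2) / x + 12 * A / x = A * (ln x + 14) / x"
    by (simp add: algebra_simps add_divide_distrib)
  ultimately show ?thesis
    unfolding f_sum by linarith
qed

theorem theorem1p3:
  shows "\<exists>c\<^sub>0 c\<^sub>1 :: real.
    (\<lambda>x :: real. (\<Sum>n :: nat | 0 < n \<and> real n \<le> x. 1 / real (totient n)) - (c\<^sub>0 + c\<^sub>1 * ln x))
      \<in> O[at_top](\<lambda>x. ln x / x)"
proof (intro exI)
  let ?A = "suminf divisor_weight"
  let ?B = "\<Sum>n. divisor_weight n * ln (real n)"
  show "(\<lambda>x :: real. (\<Sum>n :: nat | 0 < n \<and> real n \<le> x. 1 / real (totient n))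
           - ((?A * euler_mascheroni - ?B) + ?A * ln x)) \<in> O[at_top](\<lambda>x. ln x / x)"
  proof (rule bigoI)
    show "\<forall>\<^sub>F x in at_top.
        norm ((\<Sum>n :: nat | 0 < n \<and> real n \<le> x. 1 / real (totient n))
           - ((?A * euler_mascheroni - ?B) + ?A * ln x)) \<le> (15 * ?A) * norm (ln x / x)"
      \<comment> \<open>From x = e on, ln x >= 1 gives ln x + 14 <= 15 ln x; at x = 1 the comparison
        function ln x / x vanishes.\<close>
      using eventually_ge_at_top[of "exp 1"]
    proof eventually_elim
      case (elim x)
      have "(1 :: real) \<le> exp 1" by simp
      with elim have x: "x \<ge> 1" by linarith
      have ln: "ln x \<ge> 1"
        using elim x by (simp add: ln_ge_iff)
      have "{n :: nat. 0 < n \<and> real n \<le> x} = {1..nat \<lfloor>x\<rfloor>}"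
        using x by (auto simp: le_nat_iff le_floor_iff)
      then have "norm ((\<Sum>n :: nat | 0 < n \<and> real n \<le> x. 1 / real (totient n))
           - ((?A * euler_mascheroni - ?B) + ?A * ln x)) \<le> ?A * (ln x + 14) / x"
        using sum_recip_totient_asymptotic[OF x] by simp
      also have "\<dots> \<le> ?A * (15 * ln x) / x"
        using ln x summable_divisor_weight divisor_weight_nonneg
        by (intro divide_right_mono mult_left_mono suminf_nonneg) auto
      also have "\<dots> = (15 * ?A) * norm (ln x / x)"
        using ln x by simp
      finally show ?case .
    qed
  qed
qed

end
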